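(* Let $(G,K)=(A_{625},A_{624})$ or $(G,K)=(S_{625},S_{624})$. Then the following six groups all have the same order and the same degree pattern: $G$, $K\times Z_{625}$, $K\times Z_{125}\times Z_{5}$, $K\times Z_{25}\times Z_{25}$, $K\times Z_{25}\times Z_5\times Z_5$, $K\times Z_5\times Z_5\times Z_5\times Z_5$.
   Context: All groups are finite. $A_n$ and $S_n$ denote the alternating and symmetric groups of degree $n$, and $Z_n$ denotes the cyclic group of order $n$. For a finite group $G$, $\pi(G)$ is the set of prime divisors of $|G|$. The prime graph $GK(G)$ is the graph with vertex set $\pi(G)$ in which two distinct primes $r,s\in\pi(G)$ are adjacent if and only if $G$ contains an element of order $rs$. Writing $\pi(G)=\{p_1,\ldots,p_k\}$ with $p_1<p_2<\cdots<p_k$, the degree pattern of $G$ is the tuple $D(G)=(\deg(p_1),\deg(p_2),\ldots,\deg(p_k))$, where $\deg(p_i)$ is the degree of the vertex $p_i$ in $GK(G)$. *)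

theory Defs
  imports
    "HOL-Computational_Algebra.Primes"
    "HOL-Algebra.Sym_Groups"
    "HOL-Algebra.Elementary_Groups"
    "HOL-Algebra.Multiplicative_Group"
begin

text \<open>
  Simple graphs are pairs of a vertex set and a set of edges, where an edge is an unordered
  pair of distinct vertices. All notions below are intended for finite groups.
\<close>

definition graph_degree :: "'v set \<times> 'v set set \<Rightarrow> 'v \<Rightarrow> nat" where
  "graph_degree \<Gamma> v = card {e \<in> snd \<Gamma>. v \<in> e}"

definition group_primes :: "('a, 'b) monoid_scheme \<Rightarrow> nat set" where
  "group_primes G = prime_factors (order G)"

definition prime_graph :: "('a, 'b) monoid_scheme \<Rightarrow> nat set \<times> nat set set" where
  "prime_graph G =
     (group_primes G,
      {{r, s} | r s. r \<in> group_primes G \<and> s \<in> group_primes G \<and> r \<noteq> s \<and>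
                     (\<exists>x \<in> carrier G. group.ord G x = r * s)})"

definition degree_pattern :: "('a, 'b) monoid_scheme \<Rightarrow> nat list" where
  "degree_pattern G =
     map (graph_degree (prime_graph G)) (sorted_list_of_set (group_primes G))"

abbreviation cyclic :: "nat \<Rightarrow> int monoid" (\<open>Z\<^sub>c\<close>) where
  "Z\<^sub>c n \<equiv> integer_mod_group n"

text \<open>
  A relation rather than a predicate on sets of groups, since the groups compared below
  have different carrier types.
\<close>

definition same_order_and_pattern ::
    "('a, 'b) monoid_scheme \<Rightarrow> ('c, 'd) monoid_scheme \<Rightarrow> bool" where
  "same_order_and_pattern G H \<longleftrightarrow>
     order G = order H \<and> degree_pattern G = degree_pattern H"

end

theory Submission
  imports Defs
begin

text \<open>
  All groups in question have order \<open>625! = 625 * 624!\<close> or half of it, so only the prime graphs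
  matter. In any permutation group between \<open>A\<^sub>6\<^sub>2\<^sub>4\<close> and \<open>S\<^sub>6\<^sub>2\<^sub>5\<close>, distinct odd primes \<open>r\<close>, \<open>s\<close>
  are adjacent iff \<open>r + s \<le> 624\<close>: adjacency forces \<open>r + s \<le> 625\<close>, where equality fails
  by parity, and a product of an \<open>r\<close>-cycle and an \<open>s\<close>-cycle is even. The numbers 620, ..., 625 are
  composite, so all primes involved are at most 619; hence already in \<open>A\<^sub>6\<^sub>2\<^sub>4\<close> both 2 and 5 are
  adjacent to every other prime. A direct factor of order 625 can therefore add no edge.
\<close>

section \<open>Element orders\<close>

definition has_element_of_order :: "('a, 'b) monoid_scheme \<Rightarrow> nat \<Rightarrow> bool" where
  "has_element_of_order G m \<longleftrightarrow> (\<exists>x \<in> carrier G. group.ord G x = m)"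

text \<open>If \<open>r\<close> did not divide \<open>ord x\<close>, then \<open>ord x\<close> would
  be coprime to \<open>r\<close> and hence divide \<open>s\<close>, against
  \<open>x [^] s \<noteq> \<one>\<close>; the same holds with \<open>r\<close> and \<open>s\<close>
  exchanged.\<close>

lemma (in group) ord_eq_prime_mult_prime:
  assumes "x \<in> carrier G" "prime r" "prime s" "r \<noteq> s"
    and "x [^] (r * s) = \<one>" "x [^] r \<noteq> \<one>" "x [^] s \<noteq> \<one>"
  shows "ord x = r * s"
proof -
  have dvd: "ord x dvd r * s" and r: "\<not> ord x dvd r" and s: "\<not> ord x dvd s"
    using assms pow_eq_id by blast+
  have "r dvd ord x"
    using dvd s prime_imp_coprime[OF \<open>prime r\<close>, of "ord x"]
    by (metis coprime_commute coprime_dvd_mult_right_iff)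
  moreover have "s dvd ord x"
    using dvd r prime_imp_coprime[OF \<open>prime s\<close>, of "ord x"]
    by (metis coprime_commute coprime_dvd_mult_left_iff)
  moreover have "coprime r s"
    using assms primes_coprime by blast
  ultimately show ?thesis
    using dvd divides_mult dvd_antisym by blast
qed

lemma nat_pow_DirProd:
  "(x, y) [^]\<^bsub>G \<times>\<times> H\<^esub> (n::nat) = (x [^]\<^bsub>G\<^esub> n, y [^]\<^bsub>H\<^esub> n)"
  by (induction n) (simp_all add: nat_pow_def)

lemma order_DirProd: "order (G \<times>\<times> H) = order G * order H"
  by (simp add: order_def card_cartesian_product)

lemma order_integer_mod_group: "n > 0 \<Longrightarrow> order (integer_mod_group n) = n"
  by (simp add: order_def carrier_integer_mod_group)

lemma has_element_of_order_DirProd_left: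
  assumes "group G" "group H" "has_element_of_order G m"
  shows "has_element_of_order (G \<times>\<times> H) m"
proof -
  interpret G: group G by fact
  interpret H: group H by fact
  interpret P: group "G \<times>\<times> H" by (rule DirProd_group) fact+
  obtain x where x: "x \<in> carrier G" "G.ord x = m"
    using assms unfolding has_element_of_order_def by blast
  have "P.ord (x, \<one>\<^bsub>H\<^esub>) = m"
    using x G.pow_eq_id by (subst P.ord_unique) (auto simp: nat_pow_DirProd)
  thus ?thesis
    using x unfolding has_element_of_order_def by force
qed

text \<open>The order of the second component divides both \<open>m\<close> and
  \<open>order H\<close>, so this component is trivial and the first one carries the whole
  order.\<close>

lemma has_element_of_order_DirProd_coprime:
  assumes "group G" "group H" "has_element_of_order (G \<times>\<times> H) m" "coprime m (order H)"
  shows "has_element_of_order G m"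
proof -
  interpret G: group G by fact
  interpret H: group H by fact
  interpret P: group "G \<times>\<times> H" by (rule DirProd_group) fact+
  obtain x y where xy: "x \<in> carrier G" "y \<in> carrier H" "P.ord (x, y) = m"
    using assms unfolding has_element_of_order_def by auto
  have "(x, y) [^]\<^bsub>G \<times>\<times> H\<^esub> m = \<one>\<^bsub>G \<times>\<times> H\<^esub>"
    using xy P.pow_ord_eq_1[of "(x, y)"] by simp
  hence "H.ord y dvd m"
    using xy H.pow_eq_id by (simp add: nat_pow_DirProd)
  moreover have "H.ord y dvd order H"
    using xy H.ord_dvd_group_order by blast
  ultimately have "H.ord y = 1"
    using assms(4) coprime_common_divisor_nat by blast
  hence "y = \<one>\<^bsub>H\<^esub>"
    using xy H.ord_eq_1 by blast
  hence "x [^]\<^bsub>G\<^esub> n = \<one>\<^bsub>G\<^esub> \<longleftrightarrow> m dvd n" for n :: nat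
    using P.pow_eq_id[of "(x, y)" n] xy by (simp add: nat_pow_DirProd)
  hence "G.ord x = m"
    using xy G.ord_unique by blast
  thus ?thesis
    using xy unfolding has_element_of_order_def by blast
qed

section \<open>Orders of permutations\<close>

lemma nat_pow_sym_group: "p [^]\<^bsub>sym_group n\<^esub> (k::nat) = p ^^ k"
  by (induction k) (simp_all add: nat_pow_def sym_group_def funpow_Suc_right del: funpow.simps(2))

lemma nat_pow_alt_group: "p [^]\<^bsub>alt_group n\<^esub> (k::nat) = p ^^ k"
  by (simp add: nat_pow_sym_group [symmetric, where n = n] nat_pow_def alt_group_def)

text \<open>The order depends only on which iterates \<open>p ^^ k\<close> equal \<open>id\<close>,
  and neither depends on the degree. Orders thus transfer along inclusions of alternating and
  symmetric groups.\<close>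

lemma ord_alt_group_eq:
  "group.ord (alt_group n) p = group.ord (sym_group m) p"
  by (simp add: group.ord_def alt_group_is_group sym_group_is_group nat_pow_alt_group
      nat_pow_sym_group alt_group_one sym_group_one)

lemma has_element_of_order_alt_group_mono:
  assumes "has_element_of_order (alt_group m) k" "m \<le> n"
  shows "has_element_of_order (alt_group n) k"
proof -
  obtain p where p: "p permutes {1..m}" "evenperm p" "group.ord (alt_group m) p = k"
    using assms by (auto simp: has_element_of_order_def alt_group_carrier)
  have "p permutes {1..n}"
    using p(1) by (rule permutes_subset) (use assms in auto)
  \<comment> \<open>Both orders are rewritten to the one in \<open>sym_group 0\<close>; the degree 0
    is an arbitrary common choice.\<close>
  moreover have "group.ord (alt_group n) p = k"
    using p(3) by (simp add: ord_alt_group_eq [where m = 0])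
  ultimately show ?thesis
    using p by (auto simp: has_element_of_order_def alt_group_carrier)
qed

lemma has_element_of_order_alt_imp_sym:
  "has_element_of_order (alt_group n) k \<Longrightarrow> has_element_of_order (sym_group n) k"
  by (auto simp: has_element_of_order_def alt_group_carrier sym_group_carrier
      ord_alt_group_eq [where m = n])

section \<open>Orders of the symmetric and alternating groups\<close>

lemma order_sym_group: "order (sym_group n) = fact n"
  by (simp add: order_def sym_group_card_carrier)

lemma order_sym_group_Suc: "order (sym_group (Suc n)) = Suc n * order (sym_group n)"
  by (simp add: order_sym_group)

lemma order_alt_group_Suc:
  assumes "n \<ge> 2"
  shows "order (alt_group (Suc n)) = Suc n * order (alt_group n)"
proof -
  have "2 * order (alt_group (Suc n)) = fact (Suc n)"
    unfolding order_def by (rule alt_group_card_carrier) (use assms in simp)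
  also have "\<dots> = Suc n * fact n" by simp
  also have "fact n = 2 * order (alt_group n)"
    unfolding order_def by (rule alt_group_card_carrier [symmetric]) (rule assms)
  finally show ?thesis by simp
qed

lemma order_alt_group_dvd_fact: "n \<ge> 2 \<Longrightarrow> order (alt_group n) dvd fact n"
  by (metis alt_group_card_carrier dvd_triv_right order_def)

text \<open>The cycle through \<open>a\<close> has \<open>least_power p a\<close> points; all lie in
  \<open>S\<close> and share this least power, because powers of \<open>p\<close> commute and are
  injective.\<close>

lemma least_power_le_card:
  assumes "finite S" "p permutes S" "a \<in> S"
  shows "least_power p a \<le> card {b \<in> S. least_power p b = least_power p a}"
proof -
  have perm: "permutation p"
    using assms permutation_permutes by blast
  have "inj p"
    using assms permutes_inj by blast
  have "least_power p ((p ^^ i) a) = least_power p a" for i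
  proof -
    have "(p ^^ k) ((p ^^ i) a) = (p ^^ i) ((p ^^ k) a)" for k
      by (metis add.commute comp_apply funpow_add)
    hence "(p ^^ k) ((p ^^ i) a) = (p ^^ i) a \<longleftrightarrow> (p ^^ k) a = a" for k
      using inj_eq[OF inj_fn[OF \<open>inj p\<close>]] by simp
    thus ?thesis
      by (simp add: least_power_def)
  qed
  moreover have "(p ^^ i) a \<in> S" for i
    using assms permutes_in_image[OF permutes_funpow] by metis
  ultimately have "set (support p a) \<subseteq> {b \<in> S. least_power p b = least_power p a}"
    by auto
  moreover have "card (set (support p a)) = least_power p a"
    using cycle_of_permutation[OF perm, of a] distinct_card by fastforce
  ultimately show ?thesis
    using assms by (metis (no_types, lifting) card_mono finite_subset mem_Collect_eq subsetI)
qed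

text \<open>Cycle lengths divide \<open>r * s\<close>. Either some cycle has length
  \<open>r * s\<close>, which is at least \<open>r + s\<close>, or cycles of lengths
  \<open>r\<close> and \<open>s\<close> both occur, and they are disjoint.\<close>

lemma sum_of_primes_le_card_if_permutes:
  assumes "finite S" "p permutes S" "prime r" "prime s" "r \<noteq> s"
    and id: "p ^^ (r * s) = id" and r: "p ^^ r \<noteq> id" and s: "p ^^ s \<noteq> id"
  shows "r + s \<le> card S"
proof -
  have perm: "permutation p"
    using assms permutation_permutes by blast
  let ?A = "\<lambda>d. {b \<in> S. least_power p b = d}"
  have moved: "\<exists>a \<in> S. \<not> least_power p a dvd k" if "p ^^ k \<noteq> id" for k
  proof -
    obtain a where "(p ^^ k) a \<noteq> a"
      using \<open>p ^^ k \<noteq> id\<close> by (auto simp: fun_eq_iff)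
    thus ?thesis
      using permutes_not_in[OF permutes_funpow[OF assms(2)], of a k] least_power_dvd[OF perm]
      by blast
  qed
  have dvd: "least_power p a dvd r * s" for a
    by (simp add: least_power_dvd[OF perm] id)
  have divisors: "d = 1 \<or> d = r \<or> d = s \<or> d = r * s" if "d dvd r * s" for d
  proof -
    obtain x y where "d = x * y" "x dvd r" "y dvd s"
      using division_decomp[OF \<open>d dvd r * s\<close>] by blast
    moreover from this have "x = 1 \<or> x = r" "y = 1 \<or> y = s"
      using assms(3,4) prime_nat_iff by blast+
    ultimately show ?thesis by auto
  qed
  show ?thesis
  proof (cases "\<exists>a \<in> S. least_power p a = r * s")
    case True
    then obtain a where "a \<in> S" "least_power p a = r * s" by blast
    hence "r * s \<le> card (?A (r * s))"
      using least_power_le_card[OF assms(1,2)] by metis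
    also have "\<dots> \<le> card S"
      using assms(1) by (intro card_mono) auto
    finally have "r * s \<le> card S" .
    \<comment> \<open>Both factors are at least 2, so the sum is at most twice the larger one, hence
      at most the product.\<close>
    moreover have "r + s \<le> r * s"
      using prime_ge_2_nat[OF assms(3)] prime_ge_2_nat[OF assms(4)]
      by (metis add_mono_thms_linordered_semiring(1) mult_2 mult_2_right
          mult_le_mono1 mult_le_mono2 nat_le_linear order_trans)
    ultimately show ?thesis by simp
  next
    case False
    \<comment> \<open>Some cycle length does not divide \<open>r\<close>, since
      \<open>p ^^ r \<noteq> id\<close>. This excludes 1 and \<open>r\<close>, the case assumption
      excludes \<open>r * s\<close>, and \<open>s\<close> remains.\<close>
    obtain a where a: "a \<in> S" "least_power p a = s"
      using moved[OF r] divisors[OF dvd] False by (metis dvd_refl one_dvd)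
    obtain b where b: "b \<in> S" "least_power p b = r"
      using moved[OF s] divisors[OF dvd] False by (metis dvd_refl one_dvd)
    have "r + s \<le> card (?A r) + card (?A s)"
      using least_power_le_card[OF assms(1,2)] a b add_mono by metis
    also have "\<dots> = card (?A r \<union> ?A s)"
      using assms by (intro card_Un_disjoint [symmetric]) auto
    also have "\<dots> \<le> card S"
      using assms by (intro card_mono) auto
    finally show ?thesis .
  qed
qed

lemma sum_of_primes_le_if_ord_sym_group:
  assumes "has_element_of_order (sym_group n) (r * s)" "prime r" "prime s" "r \<noteq> s"
  shows "r + s \<le> n"
proof -
  interpret group "sym_group n" by (rule sym_group_is_group)
  obtain p where p: "p \<in> carrier (sym_group n)" "ord p = r * s"
    using assms unfolding has_element_of_order_def by blast
  have pow: "p ^^ k = id \<longleftrightarrow> r * s dvd k" for k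
    using pow_eq_id[OF p(1), of k] p(2) by (simp add: nat_pow_sym_group sym_group_one)
  have "\<not> r * s dvd r" "\<not> r * s dvd s"
    using assms prime_gt_1_nat[of r] prime_gt_1_nat[of s] by (auto dest!: dvd_imp_le)
  hence "r + s \<le> card {1..n}"
    using assms p pow 
    by (intro sum_of_primes_le_card_if_permutes[of _ p]) (auto simp: sym_group_carrier)
  thus ?thesis by simp
qed

section \<open>Existence of even permutations of given order\<close>

text \<open>Permutations with disjoint supports commute, so the powers of the product split.
  Primality forces the orders \<open>r\<close> and \<open>s\<close>, and the product then has order
  \<open>r * s\<close>.\<close>

lemma has_element_of_order_alt_group_if_disjoint:
  assumes "prime r" "prime s" "r \<noteq> s"
    and p: "p permutes S" "evenperm p" "p ^^ r = id" "p \<noteq> id"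
    and q: "q permutes T" "evenperm q" "q ^^ s = id" "q \<noteq> id"
    and ST: "S \<inter> T = {}" "S \<union> T \<subseteq> {1..n}"
  shows "has_element_of_order (alt_group n) (r * s)"
proof -
  interpret group "alt_group n" by (rule alt_group_is_group)
  have mem: "p \<in> carrier (alt_group n)" "q \<in> carrier (alt_group n)"
    using p(2) q(2) ST(2) permutes_subset[OF p(1)] permutes_subset[OF q(1)]
    by (simp_all add: alt_group_carrier)
  have comm: "p \<circ> q = q \<circ> p"
  proof
    fix x
    show "(p \<circ> q) x = (q \<circ> p) x"
      using ST(1) permutes_not_in[OF p(1)] permutes_not_in[OF q(1)]
        permutes_in_image[OF p(1), of x] permutes_in_image[OF q(1), of x]
      by (cases "x \<in> S"; cases "x \<in> T") (auto simp: disjoint_iff)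
  qed
  let ?x = "p \<otimes>\<^bsub>alt_group n\<^esub> q"
  have pow: "?x [^]\<^bsub>alt_group n\<^esub> k = (p ^^ k) \<circ> (q ^^ k)" for k :: nat
    using pow_mult_distrib[OF _ mem, of k] comm by (simp add: alt_group_mult nat_pow_alt_group)
  have ord: "ord p = r" "ord q = s"
  proof -
    have "ord p dvd r" "ord q dvd s"
      using pow_eq_id[of _ r] pow_eq_id[of _ s] mem p q
      by (auto simp: nat_pow_alt_group alt_group_one)
    moreover have "ord p \<noteq> 1" "ord q \<noteq> 1"
      using ord_eq_1 mem p q by (auto simp: alt_group_one)
    ultimately show "ord p = r" "ord q = s"
      using assms prime_nat_iff by blast+
  qed
  have pq: "p ^^ k = id \<longleftrightarrow> r dvd k" "q ^^ k = id \<longleftrightarrow> s dvd k" for k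
    using pow_eq_id[of _ k] mem ord by (auto simp: nat_pow_alt_group alt_group_one)
  have "\<not> r dvd s" "\<not> s dvd r"
    using assms primes_dvd_imp_eq by blast+
  hence "p ^^ s \<noteq> id" "q ^^ r \<noteq> id"
    using pq by auto
  moreover have "p ^^ (r * s) = id" "q ^^ (r * s) = id"
    using pq by auto
  ultimately have "ord ?x = r * s"
    using assms mem by (intro ord_eq_prime_mult_prime m_closed) (simp_all add: pow alt_group_one)
  thus ?thesis
    using mem unfolding has_element_of_order_def by blast
qed

text \<open>A cycle of length \<open>l\<close> is a product of \<open>l - 1\<close>
  transpositions.\<close>

lemma evenperm_cycle_of_list:
  assumes "distinct cs" "odd (length cs)"
  shows "evenperm (cycle_of_list cs)"
  using swapidseq_ext_imp_swapidseq[OF swapidseq_ext_of_cycles[OF assms(1)]] assms(2)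
  by (simp add: evenperm_unique)

lemma cycle_of_list_neq_id:
  assumes "distinct cs" "length cs \<ge> 2"
  shows "cycle_of_list cs \<noteq> id"
proof
  \<comment> \<open>The cycle maps \<open>cs\<close> entrywise to \<open>rotate1 cs\<close>, so
    being the identity would make the first two entries of \<open>cs\<close> equal.\<close>
  assume "cycle_of_list cs = id"
  hence "cs = rotate1 cs"
    using cyclic_rotation[OF assms(1), of 1] by simp
  with assms show False
    by (cases cs rule: cycle_of_list.cases) auto
qed

lemma ex_even_cycle:
  fixes T :: "nat set"
  assumes "odd s" "s \<ge> 2" "finite T" "card T = s"
  obtains q where "q permutes T" "evenperm q" "q ^^ s = id" "q \<noteq> id"
proof -
  obtain cs where cs: "set cs = T" "distinct cs"
    using assms finite_distinct_list by blast
  hence "length cs = s"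
    using assms distinct_card by force
  with cs assms show ?thesis
    using that[of "cycle_of_list cs"] cycle_permutes[of cs] evenperm_cycle_of_list[of cs]
      cycle_is_id_root[of cs] cycle_of_list_neq_id[of cs] by auto
qed

lemma has_element_of_order_alt_group_odd:
  assumes "prime r" "prime s" "r \<noteq> s" "odd r" "odd s" "r + s \<le> n"
  shows "has_element_of_order (alt_group n) (r * s)"
proof -
  obtain p where p: "p permutes {1..r}" "evenperm p" "p ^^ r = id" "p \<noteq> id"
    using assms prime_ge_2_nat by (auto intro: ex_even_cycle[of r "{1..r}"])
  obtain q where q: "q permutes {r+1..r+s}" "evenperm q" "q ^^ s = id" "q \<noteq> id"
    using assms prime_ge_2_nat by (auto intro: ex_even_cycle[of s "{r+1..r+s}"])
  show ?thesis
    by (rule has_element_of_order_alt_group_if_disjoint[OF assms(1-3) p q]) (use assms in auto)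
qed

text \<open>A single transposition is odd, so the even involution is taken as a double
  transposition; it occupies 4 points, which explains the bound \<open>s + 4\<close>.\<close>

lemma has_element_of_order_alt_group_two:
  assumes "prime s" "odd s" "s + 4 \<le> n"
  shows "has_element_of_order (alt_group n) (2 * s)"
proof -
  have two: "prime (2::nat)" "2 \<noteq> s"
    using assms by auto
  define p :: "nat \<Rightarrow> nat" where "p = transpose 1 2 \<circ> transpose 3 4"
  have p: "p permutes {1..4}" "evenperm p" "p ^^ 2 = id" "p \<noteq> id"
  proof -
    show "p permutes {1..4}"
      unfolding p_def by (intro permutes_compose permutes_swap_id) auto
    show "evenperm p"
      unfolding p_def by (simp add: evenperm_comp permutation_swap_id evenperm_swap)
    show "p ^^ 2 = id"
      by (auto simp: p_def fun_eq_iff numeral_2_eq_2 transpose_def)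
    have "p 1 = 2"
      by (simp add: p_def transpose_def)
    thus "p \<noteq> id" by auto
  qed
  obtain q where q: "q permutes {5..4+s}" "evenperm q" "q ^^ s = id" "q \<noteq> id"
    using assms prime_ge_2_nat by (auto intro: ex_even_cycle[of s "{5..4+s}"])
  show ?thesis
    by (rule has_element_of_order_alt_group_if_disjoint[OF two(1) assms(1) two(2) p q])
      (use assms in auto)
qed

section \<open>The groups of degree 624 and 625\<close>

lemma prime_le_619:
  assumes "prime (p::nat)" "p \<le> 625"
  shows "p \<le> 619"
proof (rule ccontr)
  assume "\<not> p \<le> 619"
  hence "p \<in> {620, 621, 622, 623, 624, 625}"
    using assms by auto
  \<comment> \<open>The odd candidates are 621 = 27 * 23, 623 = 7 * 89 and 625 = 5 ^ 4.\<close>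
  hence "2 dvd p \<or> 3 dvd p \<or> 5 dvd p \<or> 7 dvd p"
    by auto
  hence "2 = p \<or> 3 = p \<or> 5 = p \<or> 7 = p"
    using primes_dvd_imp_eq[OF _ assms(1), of 2] primes_dvd_imp_eq[OF _ assms(1), of 3]
      primes_dvd_imp_eq[OF _ assms(1), of 5] primes_dvd_imp_eq[OF _ assms(1), of 7]
    by fastforce
  thus False
    using \<open>\<not> p \<le> 619\<close> by auto
qed

lemma has_element_of_order_alt_group_624:
  assumes "prime r" "prime s" "r \<noteq> s" "r \<le> 625" "s \<le> 625"
    and "r \<in> {2, 5} \<or> s \<in> {2, 5} \<or> r + s \<le> 625"
  shows "has_element_of_order (alt_group 624) (r * s)"
proof -
  have le: "r \<le> 619" "s \<le> 619"
    using assms prime_le_619 by blast+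
  consider "r = 2" | "s = 2" | "odd r" "odd s"
    using assms(1,2) prime_odd_nat prime_ge_2_nat by (metis le_neq_implies_less)
  thus ?thesis
  proof cases
    case 1
    hence "odd s"
      using primes_dvd_imp_eq[OF two_is_prime_nat assms(2)] assms(3) by blast
    thus ?thesis
      using has_element_of_order_alt_group_two[OF assms(2)] 1 le by simp
  next
    case 2
    hence "odd r"
      using primes_dvd_imp_eq[OF two_is_prime_nat assms(1)] assms(3) by blast
    thus ?thesis
      using has_element_of_order_alt_group_two[OF assms(1)] 2 le by (simp add: mult.commute)
  next
    case 3
    hence "r + s \<noteq> 625" by presburger
    \<comment> \<open>If one of the primes is 5, the bound 619 on the other gives at most 624,
      exactly the available degree; otherwise the parity step just made lowers 625 to 624.\<close>
    hence "r + s \<le> 624"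
      using assms(6) 3 le by auto
    thus ?thesis
      using has_element_of_order_alt_group_odd assms 3 by blast
  qed
qed

text \<open>Equal orders give equal vertex sets, so only the edge conditions remain to be
  compared.\<close>

lemma prime_graph_eqI:
  assumes "order G = order H"
    and "\<And>r s. \<lbrakk>r \<in> group_primes G; s \<in> group_primes G; r \<noteq> s\<rbrakk> \<Longrightarrow>
           has_element_of_order G (r * s) \<longleftrightarrow> has_element_of_order H (r * s)"
  shows "prime_graph G = prime_graph H"
proof -
  have "group_primes G = group_primes H"
    using assms(1) by (simp add: group_primes_def)
  thus ?thesis
    using assms(2) unfolding prime_graph_def has_element_of_order_def
    by (intro prod_eqI) (simp_all, metis (no_types, lifting))
qed

text \<open>The abelian factors matter only through their order 625, so one statement about an
  arbitrary \<open>P\<close> covers all five products.\<close>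

lemma same_order_and_pattern_DirProd_625:
  fixes P :: "('a, 'b) monoid_scheme"
  assumes "(G, K) = (alt_group 625, alt_group 624) \<or> (G, K) = (sym_group 625, sym_group 624)"
    and "group P" "order P = 625"
  shows "same_order_and_pattern G (K \<times>\<times> P)"
proof -
  have "group K"
    using assms(1) alt_group_is_group sym_group_is_group by auto
  have order_G: "order G = 625 * order K"
    using assms(1) order_alt_group_Suc[of 624] order_sym_group_Suc[of 624] by auto
  have "order G dvd fact 625"
    using assms(1) order_alt_group_dvd_fact[of 625] order_sym_group[of 625]
    by (metis Pair_inject dvd_refl numeral_le_iff semiring_norm(68,71,72))
  have order: "order G = order (K \<times>\<times> P)"
    using order_G assms(3) by (simp add: order_DirProd)
  moreover have "prime_graph G = prime_graph (K \<times>\<times> P)"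
  proof (rule prime_graph_eqI[OF order])
    fix r s assume rs: "r \<in> group_primes G" "s \<in> group_primes G" and "r \<noteq> s"
    have prime: "prime r" "prime s"
      using rs by (auto simp: group_primes_def)
    have "r dvd order G" "s dvd order G"
      using rs by (auto simp: group_primes_def)
    hence "r dvd fact 625" "s dvd fact 625"
      using \<open>order G dvd fact 625\<close> dvd_trans by blast+
    hence le: "r \<le> 625" "s \<le> 625"
      using prime prime_dvd_fact_iff by blast+
    \<comment> \<open>This is the common adjacency criterion for \<open>G\<close>, \<open>K\<close>
      and \<open>K \<times>\<times> P\<close>. It already suffices in \<open>alt_group 624\<close>,
      which embeds in all three, and it is necessary in each of them.\<close>
    let ?adj = "r \<in> {2, 5} \<or> s \<in> {2, 5} \<or> r + s \<le> 625"
    have adj: "has_element_of_order (alt_group 624) (r * s)" if ?adj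
      using has_element_of_order_alt_group_624 prime \<open>r \<noteq> s\<close> le that by blast
    have K: "has_element_of_order K (r * s)" if ?adj
      using adj[OF that] assms(1) has_element_of_order_alt_imp_sym by auto
    have G: "has_element_of_order G (r * s)" if ?adj
      using has_element_of_order_alt_group_mono[OF adj[OF that], of 625] assms(1)
        has_element_of_order_alt_imp_sym by auto
    have G_adj: ?adj if "has_element_of_order G (r * s)"
      using that assms(1) has_element_of_order_alt_imp_sym
        sum_of_primes_le_if_ord_sym_group[OF _ prime \<open>r \<noteq> s\<close>] by auto
    have K_adj: ?adj if "has_element_of_order K (r * s)"
      using that assms(1) has_element_of_order_alt_imp_sym
        sum_of_primes_le_if_ord_sym_group[OF _ prime \<open>r \<noteq> s\<close>, of 624] by auto
    have KP_adj: ?adj if KP: "has_element_of_order (K \<times>\<times> P) (r * s)"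
    \<comment> \<open>If 5 is one of the primes, \<open>?adj\<close> holds outright. Otherwise
      \<open>r * s\<close> is coprime to \<open>order P\<close>, which is \<open>5 ^ 4\<close>, so
      \<open>K\<close> itself has an element of order \<open>r * s\<close>.\<close>
    proof (cases "r = 5 \<or> s = 5")
      case False
      have "coprime p 5" if "prime p" "p \<noteq> 5" for p :: nat
        using that primes_coprime[of p 5] by simp
      hence "coprime (r * s) 5"
        using False prime by simp
      hence "coprime (r * s) (5 ^ 4)"
        by (simp only: coprime_power_right_iff simp_thms)
      hence "coprime (r * s) (order P)"
        using assms(3) by simp
      thus ?thesis
        using has_element_of_order_DirProd_coprime[OF \<open>group K\<close> assms(2) KP] K_adj by blast
    qed auto
    show "has_element_of_order G (r * s) \<longleftrightarrow> has_element_of_order (K \<times>\<times> P) (r * s)"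
      using G G_adj KP_adj has_element_of_order_DirProd_left[OF \<open>group K\<close> assms(2) K] by blast
  qed
  ultimately show ?thesis
    by (simp add: same_order_and_pattern_def degree_pattern_def group_primes_def)
qed

theorem corollary1p8:
  fixes G K :: "(nat \<Rightarrow> nat) monoid"
  assumes "(G, K) = (alt_group 625, alt_group 624) \<or> (G, K) = (sym_group 625, sym_group 624)"
  shows "same_order_and_pattern G (K \<times>\<times> Z\<^sub>c 625) \<and>
         same_order_and_pattern G (K \<times>\<times> Z\<^sub>c 125 \<times>\<times> Z\<^sub>c 5) \<and>
         same_order_and_pattern G (K \<times>\<times> Z\<^sub>c 25 \<times>\<times> Z\<^sub>c 25) \<and>
         same_order_and_pattern G (K \<times>\<times> Z\<^sub>c 25 \<times>\<times> Z\<^sub>c 5 \<times>\<times> Z\<^sub>c 5) \<and>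
         same_order_and_pattern G (K \<times>\<times> Z\<^sub>c 5 \<times>\<times> Z\<^sub>c 5 \<times>\<times> Z\<^sub>c 5 \<times>\<times> Z\<^sub>c 5)"
  by (intro conjI same_order_and_pattern_DirProd_625[OF assms])
    (simp_all add: DirProd_group order_DirProd order_integer_mod_group)

end
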